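(* Let $0\to(M,0,T_M)\xrightarrow{i}(\hat{\mathfrak g},[\cdot,\cdot,\cdot]_{\hat{\mathfrak g}},\hat T)\xrightarrow{p}(\mathfrak g,[\cdot,\cdot,\cdot],T)\to0$ be an abelian extension of Rota-Baxter $3$-Lie algebras of weight $\lambda$, and let $s:\mathfrak g\to\hat{\mathfrak g}$ be a section (a linear map with $p\circ s=\mathrm{Id}_{\mathfrak g}$). Identify $M$ with $i(M)$, let $\rho(x,y)m=[s(x),s(y),i(m)]_{\hat{\mathfrak g}}$ for $x,y\in\mathfrak g$, $m\in M$, and define linear maps $\psi:\wedge^3\mathfrak g\to M$ and $\chi:\mathfrak g\to M$ by $$\psi(x,y,z)=[s(x),s(y),s(z)]_{\hat{\mathfrak g}}-s([x,y,z]),\qquad \chi(x)=\hat T(s(x))-s(T(x)).$$ Then $(\psi,\chi)$ is a $2$-cocycle of the Rota-Baxter $3$-Lie algebra $(\mathfrak g,[\cdot,\cdot,\cdot],T)$ with coefficients in the representation $(M,\rho,T_M)$.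
   Context: Let $k$ be a field of characteristic $0$; vector spaces are over $k$; $\lambda\in k$. A $3$-Lie algebra is a vector space $\mathfrak g$ with a linear map $[\cdot,\cdot,\cdot]:\wedge^3\mathfrak g\to\mathfrak g$ such that $[x_1,x_2,[x_3,x_4,x_5]]=[[x_1,x_2,x_3],x_4,x_5]+[x_3,[x_1,x_2,x_4],x_5]+[x_3,x_4,[x_1,x_2,x_5]]$. A representation on $M$ is a linear map $\rho:\wedge^2\mathfrak g\to\mathfrak{gl}(M)$ with $\rho(x_1,x_2)\rho(x_3,x_4)=\rho([x_1,x_2,x_3],x_4)+\rho(x_3,[x_1,x_2,x_4])+\rho(x_3,x_4)\rho(x_1,x_2)$ and $\rho(x_1,[x_2,x_3,x_4])=\rho(x_3,x_4)\rho(x_1,x_2)-\rho(x_2,x_4)\rho(x_1,x_3)+\rho(x_2,x_3)\rho(x_1,x_4)$. A Rota-Baxter $3$-Lie algebra of weight $\lambda$ is a $3$-Lie algebra with a linear map $T:\mathfrak g\to\mathfrak g$ such that $[T(x),T(y),T(z)]=T([x,y,z]_T)$, where $[x,y,z]_T:=[T(x),T(y),z]+[T(x),y,T(z)]+[x,T(y),T(z)]+\lambda[T(x),y,z]+\lambda[x,T(y),z]+\lambda[x,y,T(z)]+\lambda^2[x,y,z]$. Morphisms are $3$-Lie algebra homomorphisms commuting with the operators. A representation is a triple $(M,\rho,T_M)$ with $(M,\rho)$ a representation of the $3$-Lie algebra and $T_M\in\mathrm{End}(M)$ satisfying $\rho(T(x),T(y))T_M(m)=T_M\big(\rho(T(x),T(y))m+\rho(T(x),y)T_M(m)+\rho(x,T(y))T_M(m)+\lambda\rho(T(x),y)m+\lambda\rho(x,T(y))m+\lambda\rho(x,y)T_M(m)+\lambda^2\rho(x,y)m\big)$.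 A vector space $M$ with $T_M\in\mathrm{End}(M)$ is regarded as a Rota-Baxter $3$-Lie algebra $(M,0,T_M)$ with zero bracket. An abelian extension of $(\mathfrak g,[\cdot,\cdot,\cdot],T)$ by $(M,0,T_M)$ is a short exact sequence $0\to M\xrightarrow{i}\hat{\mathfrak g}\xrightarrow{p}\mathfrak g\to0$ of morphisms of Rota-Baxter $3$-Lie algebras of weight $\lambda$ such that $[u,i(m),i(n)]_{\hat{\mathfrak g}}=0$ for all $u\in\hat{\mathfrak g}$, $m,n\in M$. It is known that, for any section $s$, the formula for $\rho$ in the statement makes $(M,\rho,T_M)$ a representation of $(\mathfrak g,[\cdot,\cdot,\cdot],T)$. 2-cocycles. Put $\rho_T(x,y)m=\rho(T(x),T(y))m-T_M\big(\rho(T(x),y)m+\rho(x,T(y))m+\lambda\rho(x,y)m\big)$. The $2$-cochains are $\mathrm{Hom}(\wedge^3\mathfrak g,M)\oplus\mathrm{Hom}(\mathfrak g,M)$ with $d^2(f,g)=(\delta^2f,-\partial^1g-\Phi^2f)$, where $(\delta^2f)(x_1,\dots,x_5)=-f([x_1,x_2,x_3],x_4,x_5)-f(x_3,[x_1,x_2,x_4],x_5)-f(x_3,x_4,[x_1,x_2,x_5])+f(x_1,x_2,[x_3,x_4,x_5])+\rho(x_1,x_2)f(x_3,x_4,x_5)-\rho(x_3,x_4)f(x_1,x_2,x_5)-\rho(x_4,x_5)f(x_1,x_2,x_3)-\rho(x_5,x_3)f(x_1,x_2,x_4)$; $(\partial^1g)(x,y,z)=-g([x,y,z]_T)+\rho_T(x,y)g(z)+\rho_T(y,z)g(x)+\rho_T(z,x)g(y)$;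 $(\Phi^2f)(x,y,z)=f(T(x),T(y),T(z))-T_M\big(f(T(x),T(y),z)+f(T(x),y,T(z))+f(x,T(y),T(z))+\lambda f(T(x),y,z)+\lambda f(x,T(y),z)+\lambda f(x,y,T(z))+\lambda^2f(x,y,z)\big)$. A $2$-cocycle is a pair $(f,g)$ with $d^2(f,g)=0$. *)

theory Defs
  imports Complex_Main
begin

text \<open>
  Vector spaces over \<open>'k\<close> are types of class \<open>ab_group_add\<close> with an explicit scalar multiplication
  satisfying the locale \<open>vector_space\<close>. A linear map on an exterior power is an alternating
  multilinear map, written in curried form; a linear map into \<open>gl(M)\<close> takes the element of \<open>M\<close> as
  a further argument.
\<close>

definition alternating2 ::
  "('k::field \<Rightarrow> 'a::ab_group_add \<Rightarrow> 'a) \<Rightarrow> ('k \<Rightarrow> 'b::ab_group_add \<Rightarrow> 'b) \<Rightarrow> ('a \<Rightarrow> 'a \<Rightarrow> 'b) \<Rightarrow> bool"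
  where "alternating2 sA sB f \<longleftrightarrow>
    (\<forall>y. Vector_Spaces.linear sA sB (\<lambda>x. f x y)) \<and>
    (\<forall>x. Vector_Spaces.linear sA sB (\<lambda>y. f x y)) \<and>
    (\<forall>x. f x x = 0)"

definition alternating3 ::
  "('k::field \<Rightarrow> 'a::ab_group_add \<Rightarrow> 'a) \<Rightarrow> ('k \<Rightarrow> 'b::ab_group_add \<Rightarrow> 'b) \<Rightarrow> ('a \<Rightarrow> 'a \<Rightarrow> 'a \<Rightarrow> 'b) \<Rightarrow> bool"
  where "alternating3 sA sB f \<longleftrightarrow>
    (\<forall>y z. Vector_Spaces.linear sA sB (\<lambda>x. f x y z)) \<and>
    (\<forall>x z. Vector_Spaces.linear sA sB (\<lambda>y. f x y z)) \<and>
    (\<forall>x y. Vector_Spaces.linear sA sB (\<lambda>z. f x y z)) \<and>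
    (\<forall>x y. f x x y = 0 \<and> f x y x = 0 \<and> f y x x = 0)"

locale three_lie_algebra = vector_space scale
  for scale :: "'k::field_char_0 \<Rightarrow> 'g::ab_group_add \<Rightarrow> 'g" +
  fixes br :: "'g \<Rightarrow> 'g \<Rightarrow> 'g \<Rightarrow> 'g"
  assumes br_alternating: "alternating3 scale scale br"
    and fundamental_identity:
      "br x1 x2 (br x3 x4 x5) = br (br x1 x2 x3) x4 x5 + br x3 (br x1 x2 x4) x5 + br x3 x4 (br x1 x2 x5)"

locale three_lie_representation =
  three_lie_algebra sG br + M: vector_space sM
  for sG :: "'k::field_char_0 \<Rightarrow> 'g::ab_group_add \<Rightarrow> 'g" and br
    and sM :: "'k \<Rightarrow> 'm::ab_group_add \<Rightarrow> 'm" +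
  fixes \<rho> :: "'g \<Rightarrow> 'g \<Rightarrow> 'm \<Rightarrow> 'm"
  assumes rho_endo: "Vector_Spaces.linear sM sM (\<rho> x y)"
    and rho_alternating: "alternating2 sG sM (\<lambda>x y. \<rho> x y m)"
    and rho_rho: "\<rho> x1 x2 (\<rho> x3 x4 m) =
      \<rho> (br x1 x2 x3) x4 m + \<rho> x3 (br x1 x2 x4) m + \<rho> x3 x4 (\<rho> x1 x2 m)"
    and rho_br: "\<rho> x1 (br x2 x3 x4) m =
      \<rho> x3 x4 (\<rho> x1 x2 m) - \<rho> x2 x4 (\<rho> x1 x3 m) + \<rho> x2 x3 (\<rho> x1 x4 m)"

definition rb_bracket ::
  "('k::field \<Rightarrow> 'g::ab_group_add \<Rightarrow> 'g) \<Rightarrow> ('g \<Rightarrow> 'g \<Rightarrow> 'g \<Rightarrow> 'g) \<Rightarrow> 'k \<Rightarrow> ('g \<Rightarrow> 'g) \<Rightarrow> 'g \<Rightarrow> 'g \<Rightarrow> 'g \<Rightarrow> 'g"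
  where "rb_bracket scale br lam T x y z =
    br (T x) (T y) z + br (T x) y (T z) + br x (T y) (T z)
    + scale lam (br (T x) y z) + scale lam (br x (T y) z) + scale lam (br x y (T z))
    + scale (lam\<^sup>2) (br x y z)"

locale rb_three_lie_algebra = three_lie_algebra scale br
  for scale :: "'k::field_char_0 \<Rightarrow> 'g::ab_group_add \<Rightarrow> 'g" and br +
  fixes lam :: 'k and T :: "'g \<Rightarrow> 'g"
  assumes T_linear: "Vector_Spaces.linear scale scale T"
    and rota_baxter: "br (T x) (T y) (T z) = T (rb_bracket scale br lam T x y z)"

locale rb_three_lie_hom =
  A: rb_three_lie_algebra sA brA lam TA + B: rb_three_lie_algebra sB brB lam TB
  for sA :: "'k::field_char_0 \<Rightarrow> 'a::ab_group_add \<Rightarrow> 'a" and brA TA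
    and sB :: "'k \<Rightarrow> 'b::ab_group_add \<Rightarrow> 'b" and brB TB and lam +
  fixes \<phi> :: "'a \<Rightarrow> 'b"
  assumes hom_linear: "Vector_Spaces.linear sA sB \<phi>"
    and hom_br: "\<phi> (brA x y z) = brB (\<phi> x) (\<phi> y) (\<phi> z)"
    and hom_T: "\<phi> (TA x) = TB (\<phi> x)"

locale rb_three_lie_representation =
  rb_three_lie_algebra sG br lam T + three_lie_representation sG br sM \<rho>
  for sG :: "'k::field_char_0 \<Rightarrow> 'g::ab_group_add \<Rightarrow> 'g" and br lam T
    and sM :: "'k \<Rightarrow> 'm::ab_group_add \<Rightarrow> 'm" and \<rho> +
  fixes TM :: "'m \<Rightarrow> 'm"
  assumes TM_linear: "Vector_Spaces.linear sM sM TM"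
    and rho_TM: "\<rho> (T x) (T y) (TM m) =
      TM (\<rho> (T x) (T y) m + \<rho> (T x) y (TM m) + \<rho> x (T y) (TM m)
          + sM lam (\<rho> (T x) y m) + sM lam (\<rho> x (T y) m) + sM lam (\<rho> x y (TM m))
          + sM (lam\<^sup>2) (\<rho> x y m))"

locale rb_abelian_extension =
  I: rb_three_lie_hom sM "\<lambda>_ _ _. 0" TM sH brH TH lam i +
  P: rb_three_lie_hom sH brH TH sG brG TG lam p
  for sM :: "'k::field_char_0 \<Rightarrow> 'm::ab_group_add \<Rightarrow> 'm" and TM
    and sH :: "'k \<Rightarrow> 'h::ab_group_add \<Rightarrow> 'h" and brH TH
    and sG :: "'k \<Rightarrow> 'g::ab_group_add \<Rightarrow> 'g" and brG TG
    and lam and i p +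
  assumes inj_i: "inj i"
    and exact: "range i = {u. p u = 0}"
    and surj_p: "surj p"
    and abelian: "brH u (i m) (i n) = 0"

definition linear_section ::
  "('k::field \<Rightarrow> 'g::ab_group_add \<Rightarrow> 'g) \<Rightarrow> ('k \<Rightarrow> 'h::ab_group_add \<Rightarrow> 'h) \<Rightarrow> ('h \<Rightarrow> 'g) \<Rightarrow> ('g \<Rightarrow> 'h) \<Rightarrow> bool"
  where "linear_section sG sH p s \<longleftrightarrow> Vector_Spaces.linear sG sH s \<and> p \<circ> s = id"

text \<open>
  The identification of \<open>M\<close> with \<open>i(M)\<close> is made by \<open>inv i\<close>; for an abelian extension and a section the
  arguments of \<open>inv i\<close> below do lie in \<open>range i\<close> (lemmas \<open>i_ext_rho\<close>, \<open>i_ext_psi\<close>, \<open>i_ext_chi\<close>).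
\<close>

definition ext_rho :: "('h \<Rightarrow> 'h \<Rightarrow> 'h \<Rightarrow> 'h) \<Rightarrow> ('m \<Rightarrow> 'h) \<Rightarrow> ('g \<Rightarrow> 'h) \<Rightarrow> 'g \<Rightarrow> 'g \<Rightarrow> 'm \<Rightarrow> 'm"
  where "ext_rho brH i s x y m = inv i (brH (s x) (s y) (i m))"

definition ext_psi ::
  "('h::ab_group_add \<Rightarrow> 'h \<Rightarrow> 'h \<Rightarrow> 'h) \<Rightarrow> ('g \<Rightarrow> 'g \<Rightarrow> 'g \<Rightarrow> 'g) \<Rightarrow> ('m \<Rightarrow> 'h) \<Rightarrow> ('g \<Rightarrow> 'h) \<Rightarrow> 'g \<Rightarrow> 'g \<Rightarrow> 'g \<Rightarrow> 'm"
  where "ext_psi brH brG i s x y z = inv i (brH (s x) (s y) (s z) - s (brG x y z))"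

definition ext_chi ::
  "('h::ab_group_add \<Rightarrow> 'h) \<Rightarrow> ('g \<Rightarrow> 'g) \<Rightarrow> ('m \<Rightarrow> 'h) \<Rightarrow> ('g \<Rightarrow> 'h) \<Rightarrow> 'g \<Rightarrow> 'm"
  where "ext_chi TH TG i s x = inv i (TH (s x) - s (TG x))"

definition rho_T ::
  "('k \<Rightarrow> 'm::ab_group_add \<Rightarrow> 'm) \<Rightarrow> 'k \<Rightarrow> ('g \<Rightarrow> 'g) \<Rightarrow> ('g \<Rightarrow> 'g \<Rightarrow> 'm \<Rightarrow> 'm) \<Rightarrow> ('m \<Rightarrow> 'm) \<Rightarrow> 'g \<Rightarrow> 'g \<Rightarrow> 'm \<Rightarrow> 'm"
  where "rho_T sM lam T \<rho> TM x y m =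
    \<rho> (T x) (T y) m - TM (\<rho> (T x) y m + \<rho> x (T y) m + sM lam (\<rho> x y m))"

definition delta2 ::
  "('g \<Rightarrow> 'g \<Rightarrow> 'g \<Rightarrow> 'g) \<Rightarrow> ('g \<Rightarrow> 'g \<Rightarrow> 'm::ab_group_add \<Rightarrow> 'm) \<Rightarrow> ('g \<Rightarrow> 'g \<Rightarrow> 'g \<Rightarrow> 'm)
    \<Rightarrow> 'g \<Rightarrow> 'g \<Rightarrow> 'g \<Rightarrow> 'g \<Rightarrow> 'g \<Rightarrow> 'm"
  where "delta2 br \<rho> f x1 x2 x3 x4 x5 =
    - f (br x1 x2 x3) x4 x5 - f x3 (br x1 x2 x4) x5 - f x3 x4 (br x1 x2 x5) + f x1 x2 (br x3 x4 x5)
    + \<rho> x1 x2 (f x3 x4 x5) - \<rho> x3 x4 (f x1 x2 x5) - \<rho> x4 x5 (f x1 x2 x3) - \<rho> x5 x3 (f x1 x2 x4)"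

definition partial1 ::
  "('k::field \<Rightarrow> 'g::ab_group_add \<Rightarrow> 'g) \<Rightarrow> ('g \<Rightarrow> 'g \<Rightarrow> 'g \<Rightarrow> 'g) \<Rightarrow> 'k \<Rightarrow> ('g \<Rightarrow> 'g)
    \<Rightarrow> ('k \<Rightarrow> 'm::ab_group_add \<Rightarrow> 'm) \<Rightarrow> ('g \<Rightarrow> 'g \<Rightarrow> 'm \<Rightarrow> 'm) \<Rightarrow> ('m \<Rightarrow> 'm)
    \<Rightarrow> ('g \<Rightarrow> 'm) \<Rightarrow> 'g \<Rightarrow> 'g \<Rightarrow> 'g \<Rightarrow> 'm"
  where "partial1 sG br lam T sM \<rho> TM g x y z =
    - g (rb_bracket sG br lam T x y z)
    + rho_T sM lam T \<rho> TM x y (g z) + rho_T sM lam T \<rho> TM y z (g x) + rho_T sM lam T \<rho> TM z x (g y)"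

definition Phi2 ::
  "'k::field \<Rightarrow> ('g \<Rightarrow> 'g) \<Rightarrow> ('k \<Rightarrow> 'm::ab_group_add \<Rightarrow> 'm) \<Rightarrow> ('m \<Rightarrow> 'm)
    \<Rightarrow> ('g \<Rightarrow> 'g \<Rightarrow> 'g \<Rightarrow> 'm) \<Rightarrow> 'g \<Rightarrow> 'g \<Rightarrow> 'g \<Rightarrow> 'm"
  where "Phi2 lam T sM TM f x y z =
    f (T x) (T y) (T z)
    - TM (f (T x) (T y) z + f (T x) y (T z) + f x (T y) (T z)
          + sM lam (f (T x) y z) + sM lam (f x (T y) z) + sM lam (f x y (T z))
          + sM (lam\<^sup>2) (f x y z))"

definition rb_d2 ::
  "('k::field \<Rightarrow> 'g::ab_group_add \<Rightarrow> 'g) \<Rightarrow> ('g \<Rightarrow> 'g \<Rightarrow> 'g \<Rightarrow> 'g) \<Rightarrow> 'k \<Rightarrow> ('g \<Rightarrow> 'g)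
    \<Rightarrow> ('k \<Rightarrow> 'm::ab_group_add \<Rightarrow> 'm) \<Rightarrow> ('g \<Rightarrow> 'g \<Rightarrow> 'm \<Rightarrow> 'm) \<Rightarrow> ('m \<Rightarrow> 'm)
    \<Rightarrow> ('g \<Rightarrow> 'g \<Rightarrow> 'g \<Rightarrow> 'm) \<times> ('g \<Rightarrow> 'm)
    \<Rightarrow> ('g \<Rightarrow> 'g \<Rightarrow> 'g \<Rightarrow> 'g \<Rightarrow> 'g \<Rightarrow> 'm) \<times> ('g \<Rightarrow> 'g \<Rightarrow> 'g \<Rightarrow> 'm)"
  where "rb_d2 sG br lam T sM \<rho> TM = (\<lambda>(f, g).
    (delta2 br \<rho> f,
     \<lambda>x y z. - partial1 sG br lam T sM \<rho> TM g x y z - Phi2 lam T sM TM f x y z))"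

definition rb_cochains2 ::
  "('k::field \<Rightarrow> 'g::ab_group_add \<Rightarrow> 'g) \<Rightarrow> ('k \<Rightarrow> 'm::ab_group_add \<Rightarrow> 'm)
    \<Rightarrow> (('g \<Rightarrow> 'g \<Rightarrow> 'g \<Rightarrow> 'm) \<times> ('g \<Rightarrow> 'm)) set"
  where "rb_cochains2 sG sM = {(f, g). alternating3 sG sM f \<and> Vector_Spaces.linear sG sM g}"

definition rb_cocycles2 ::
  "('k::field \<Rightarrow> 'g::ab_group_add \<Rightarrow> 'g) \<Rightarrow> ('g \<Rightarrow> 'g \<Rightarrow> 'g \<Rightarrow> 'g) \<Rightarrow> 'k \<Rightarrow> ('g \<Rightarrow> 'g)
    \<Rightarrow> ('k \<Rightarrow> 'm::ab_group_add \<Rightarrow> 'm) \<Rightarrow> ('g \<Rightarrow> 'g \<Rightarrow> 'm \<Rightarrow> 'm) \<Rightarrow> ('m \<Rightarrow> 'm)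
    \<Rightarrow> (('g \<Rightarrow> 'g \<Rightarrow> 'g \<Rightarrow> 'm) \<times> ('g \<Rightarrow> 'm)) set"
  where "rb_cocycles2 sG br lam T sM \<rho> TM =
    {c \<in> rb_cochains2 sG sM. rb_d2 sG br lam T sM \<rho> TM c = (\<lambda>_ _ _ _ _. 0, \<lambda>_ _ _. 0)}"

context rb_abelian_extension
begin

context
  fixes s
  assumes s: "linear_section sG sH p s"
begin

lemma p_s: "p (s x) = x"
  using s by (auto simp: linear_section_def fun_eq_iff)

lemma i_inv: "p u = 0 \<Longrightarrow> i (inv i u) = u"
  using exact by (intro f_inv_into_f) blast

lemma p_i: "p (i m) = 0"
  using exact by blast

lemma i_ext_rho: "i (ext_rho brH i s x y m) = brH (s x) (s y) (i m)"
proof -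
  have "brG x y 0 = 0"
    using P.B.br_alternating unfolding alternating3_def by (metis linear_0 module_hom.zero linear_iff_module_hom)
  then show ?thesis
    unfolding ext_rho_def by (intro i_inv) (simp add: P.hom_br p_s p_i)
qed

lemma i_ext_psi: "i (ext_psi brH brG i s x y z) = brH (s x) (s y) (s z) - s (brG x y z)"
  unfolding ext_psi_def using P.hom_linear
  by (intro i_inv) (simp add: module_hom.diff linear_iff_module_hom P.hom_br p_s)

lemma i_ext_chi: "i (ext_chi TH TG i s x) = TH (s x) - s (TG x)"
  unfolding ext_chi_def using P.hom_linear
  by (intro i_inv) (simp add: module_hom.diff linear_iff_module_hom P.hom_T p_s)

lemma ext_rho_representation:
  "rb_three_lie_representation sG brG lam TG sM (ext_rho brH i s) TM"
proof -
  note R = i_ext_rho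
  have H: "brH (a + b) c d = brH a c d + brH b c d" "brH c (a + b) d = brH c a d + brH c b d"
    "brH c d (a + b) = brH c d a + brH c d b"
    "brH (sH r a) c d = sH r (brH a c d)" "brH c (sH r a) d = sH r (brH c a d)"
    "brH c d (sH r a) = sH r (brH c d a)"
    and alt: "brH a a c = 0" "brH a c a = 0" "brH c a a = 0" for a b c d r
    using I.B.br_alternating by (simp_all add: alternating3_def Vector_Spaces.linear_iff)
  have H0: "brH 0 c d = 0" "brH c 0 d = 0" for c d
    using H(1)[of 0 0] H(2)[of c 0 0] by simp_all
  have sw12: "brH a b c = - brH b a c" and sw23: "brH a b c = - brH a c b" for a b c
    using alt(1)[of "a + b" c] alt(3)[of a "b + c"] unfolding H
    by (simp_all add: alt add_eq_0_iff add.commute)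
  have neg: "brH a (- b) c = - brH a b c" for a b c
    using H(2)[of a b "- b" c] H0 by (simp add: eq_neg_iff_add_eq_0 add.commute)
  have ii: "brH u (i m) (i n) = 0" "brH (i m) u (i n) = 0" "brH (i m) (i n) u = 0" for u m n
    using abelian sw12[of "i m" u "i n"] sw23[of "i m" "i n" u] by simp_all
  have S: "s (a + b) = s a + s b" "s (sG r a) = sH r (s a)" for a b r
    using s by (simp_all add: linear_section_def Vector_Spaces.linear_iff)
  have J: "i (a + b) = i a + i b" "i (sM r c) = sH r (i c)" for a b r c
    using I.hom_linear by (simp_all add: Vector_Spaces.linear_iff)
  have J0: "i 0 = 0"
    using J(1)[of 0 0] by simp
  have Jm: "i (a - b) = i a - i b" for a b
    using J(1)[of "a - b" b] by simp
  have sbr: "s (brG x y z) = brH (s x) (s y) (s z) + i (- ext_psi brH brG i s x y z)" for x y z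
    using i_ext_psi[of x y z] Jm[of 0 "ext_psi brH brG i s x y z"] J0 by simp
  have sT: "s (TG x) = TH (s x) + i (- ext_chi TH TG i s x)" for x
    using i_ext_chi[of x] Jm[of 0 "ext_chi TH TG i s x"] J0 by simp
  have iT: "brH u (i m) (TH (i n)) = 0" "brH (i m) u (TH (i n)) = 0" for u m n
    using ii[where n = "TM n"] by (simp_all add: I.hom_T)
  show ?thesis
  proof (intro rb_three_lie_representation.intro three_lie_representation.intro
      three_lie_representation_axioms.intro rb_three_lie_representation_axioms.intro
      P.B.rb_three_lie_algebra_axioms P.B.three_lie_algebra_axioms I.A.vector_space_axioms)
    show "Vector_Spaces.linear sM sM (ext_rho brH i s x y)" for x y
      unfolding Vector_Spaces.linear_iff
      by (auto intro!: injD[OF inj_i] simp: R H S J I.A.vector_space_axioms)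
    show "alternating2 sG sM (\<lambda>x y. ext_rho brH i s x y m)" for m
      unfolding alternating2_def Vector_Spaces.linear_iff
      by (auto intro!: injD[OF inj_i]
          simp: R H S J J0 alt I.A.vector_space_axioms P.B.vector_space_axioms)
    fix x1 x2 x3 x4 m
    show "ext_rho brH i s x1 x2 (ext_rho brH i s x3 x4 m) =
      ext_rho brH i s (brG x1 x2 x3) x4 m + ext_rho brH i s x3 (brG x1 x2 x4) m
      + ext_rho brH i s x3 x4 (ext_rho brH i s x1 x2 m)"
      by (rule injD[OF inj_i])
        (simp add: R J sbr H ii I.B.fundamental_identity[of "s x1" "s x2" "s x3" "s x4" "i m"])
    have cyc: "brH a b c = brH b c a" for a b c
      by (metis sw12 sw23 minus_minus)
    have "brH (s x1) (brH (s x2) (s x3) (s x4)) (i m) = brH (i m) (s x1) (brH (s x2) (s x3) (s x4))"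
      by (rule cyc[symmetric])
    also have "\<dots> = brH (brH (i m) (s x1) (s x2)) (s x3) (s x4)
        + brH (s x2) (brH (i m) (s x1) (s x3)) (s x4) + brH (s x2) (s x3) (brH (i m) (s x1) (s x4))"
      by (rule I.B.fundamental_identity)
    also have "\<dots> = brH (s x3) (s x4) (brH (s x1) (s x2) (i m))
        - brH (s x2) (s x4) (brH (s x1) (s x3) (i m)) + brH (s x2) (s x3) (brH (s x1) (s x4) (i m))"
      unfolding cyc[of "i m" "s x1"] cyc[of "brH (s x1) (s x2) (i m)"]
        sw23[of "s x2" "brH (s x1) (s x3) (i m)" "s x4"] by simp
    finally show "ext_rho brH i s x1 (brG x2 x3 x4) m =
      ext_rho brH i s x3 x4 (ext_rho brH i s x1 x2 m) - ext_rho brH i s x2 x4 (ext_rho brH i s x1 x3 m)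
      + ext_rho brH i s x2 x3 (ext_rho brH i s x1 x4 m)"
      by (intro injD[OF inj_i]) (simp add: R J Jm sbr H ii)
  next
    show "Vector_Spaces.linear sM sM TM"
      by (rule I.A.T_linear)
    fix x y m
    show "ext_rho brH i s (TG x) (TG y) (TM m) =
      TM (ext_rho brH i s (TG x) (TG y) m + ext_rho brH i s (TG x) y (TM m) + ext_rho brH i s x (TG y) (TM m)
          + sM lam (ext_rho brH i s (TG x) y m) + sM lam (ext_rho brH i s x (TG y) m)
          + sM lam (ext_rho brH i s x y (TM m)) + sM (lam\<^sup>2) (ext_rho brH i s x y m))"
      using I.B.rota_baxter[of "s x" "s y" "i m"]
      by (intro injD[OF inj_i]) (simp add: R J sT H ii iT rb_bracket_def I.hom_T)
  qed
qed

end

end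

end

theory Submission
  imports Defs
begin

text \<open>
  Push everything into the total algebra with the injection \<open>i\<close> and decompose along the section:
  the bracket of \<open>s x\<close>, \<open>s y\<close>, \<open>s z\<close> is \<open>s [x, y, z] + i (\<psi> x y z)\<close>, and the operator sends \<open>s x\<close>
  to \<open>s (T x) + i (\<chi> x)\<close>. Brackets with two entries in \<open>i(M)\<close> vanish and those with one give \<open>\<rho>\<close>.
  The \<open>M\<close>-components of the fundamental identity and of the Rota-Baxter identity at elements of the
  form \<open>s x\<close> are then the two components of the cocycle condition.
\<close>

context three_lie_algebra
begin

lemma br_add:
  "br (a + b) c d = br a c d + br b c d"
  "br c (a + b) d = br c a d + br c b d"
  "br c d (a + b) = br c d a + br c d b"
  using br_alternating by (simp_all add: alternating3_def Vector_Spaces.linear_iff)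

lemma br_scale:
  "br (scale r a) c d = scale r (br a c d)"
  "br c (scale r a) d = scale r (br c a d)"
  "br c d (scale r a) = scale r (br c d a)"
  using br_alternating by (simp_all add: alternating3_def Vector_Spaces.linear_iff)

lemma br_same [simp]: "br a a c = 0" "br a c a = 0" "br c a a = 0"
  using br_alternating by (simp_all add: alternating3_def)

text \<open>Polarisation: alternation is given as vanishing on repeated entries, so expand
  \<open>br (a + b) (a + b) c = 0\<close>.\<close>

lemma br_swap12: "br a b c = - br b a c"
  using br_same(1)[of "a + b" c] unfolding br_add by (simp add: add_eq_0_iff)

lemma br_swap23: "br a b c = - br a c b"
  using br_same(3)[of a "b + c"] unfolding br_add by (simp add: add_eq_0_iff)

lemma br_cyclic: "br a b c = br b c a"
  by (metis br_swap12 br_swap23 minus_minus)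

end

context rb_abelian_extension
begin

lemma module_hom_i: "module_hom sM sH i"
  using I.hom_linear by (simp add: linear_iff_module_hom)

lemmas i_add = module_hom.add[OF module_hom_i]
  and i_scale = module_hom.scale[OF module_hom_i]
  and i_zero = module_hom.zero[OF module_hom_i]
  and i_diff = module_hom.diff[OF module_hom_i]
  and i_minus = module_hom.neg[OF module_hom_i]

lemma TH_add: "TH (a + b) = TH a + TH b"
  using I.B.T_linear by (simp add: Vector_Spaces.linear_iff)

lemma TM_add: "TM (a + b) = TM a + TM b"
  using I.A.T_linear by (simp add: Vector_Spaces.linear_iff)

text \<open>The abelian hypothesis speaks of the last two slots; skew-symmetry carries it to the
  other pairs.\<close>

lemma br_two_kernel:
  "brH u (i m) (i n) = 0" "brH (i m) u (i n) = 0" "brH (i m) (i n) u = 0"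
  using abelian I.B.br_swap12[of "i m" u "i n"] I.B.br_swap23[of "i m" "i n" u] by simp_all

context
  fixes s
  assumes section_s: "linear_section sG sH p s"
begin

abbreviation "rh \<equiv> ext_rho brH i s"
abbreviation "psi \<equiv> ext_psi brH brG i s"
abbreviation "chi \<equiv> ext_chi TH TG i s"

lemmas i_rho = i_ext_rho[OF section_s]
  and i_psi = i_ext_psi[OF section_s]
  and i_chi = i_ext_chi[OF section_s]

lemma s_add: "s (a + b) = s a + s b"
  and s_scale: "s (sG r a) = sH r (s a)"
  using section_s by (simp_all add: linear_section_def Vector_Spaces.linear_iff)

lemma s_zero: "s 0 = 0"
  using s_add[of 0 0] by simp

lemma br_section: "brH (s x) (s y) (s z) = s (brG x y z) + i (psi x y z)"
  by (simp add: i_psi)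

lemma TH_section: "TH (s x) = s (TG x) + i (chi x)"
  by (simp add: i_chi)

text \<open>Cyclic permutations are even, so moving the kernel entry to the last slot costs no sign.
  The third form accounts for the order of arguments in terms such as \<open>rh x5 x3\<close> of the
  coboundary.\<close>

lemma br_one_kernel:
  "brH (s x) (s y) (i m) = i (rh x y m)"
  "brH (i m) (s x) (s y) = i (rh x y m)"
  "brH (s y) (i m) (s x) = i (rh x y m)"
  using I.B.br_cyclic[of "i m" "s x" "s y"] I.B.br_cyclic[of "s y" "i m" "s x"]
  by (simp_all add: i_rho)

text \<open>Injectivity of \<open>i\<close> moves the claim into the total algebra, where
  \<open>psi\<close> is a difference of two expressions additive in each argument.\<close>

lemma psi_add:
  "psi (a + b) y z = psi a y z + psi b y z"
  "psi y (a + b) z = psi y a z + psi y b z"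
  "psi y z (a + b) = psi y z a + psi y z b"
  by (rule injD[OF inj_i], simp only: i_psi i_add s_add I.B.br_add P.B.br_add add_diff_add)+

lemma psi_scale:
  "psi (sG r a) y z = sM r (psi a y z)"
  "psi y (sG r a) z = sM r (psi y a z)"
  "psi y z (sG r a) = sM r (psi y z a)"
  by (rule injD[OF inj_i], simp only: i_psi i_scale s_scale I.B.br_scale P.B.br_scale
      I.B.scale_right_diff_distrib)+

lemma psi_same: "psi x x y = 0" "psi x y x = 0" "psi y x x = 0"
  by (rule injD[OF inj_i], simp only: i_psi i_zero s_zero I.B.br_same P.B.br_same diff_self)+

lemma psi_alternating: "alternating3 sG sM psi"
  unfolding alternating3_def Vector_Spaces.linear_iff
  by (intro conjI allI I.A.vector_space_axioms P.B.vector_space_axioms psi_add psi_scale psi_same)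

lemma chi_linear: "Vector_Spaces.linear sG sM chi"
  using I.B.T_linear P.B.T_linear
  unfolding Vector_Spaces.linear_iff
  by (auto intro!: injD[OF inj_i] I.A.vector_space_axioms
      simp: i_chi i_add i_scale s_add s_scale I.B.scale_right_diff_distrib algebra_simps)

lemma delta2_psi: "delta2 brG rh psi x1 x2 x3 x4 x5 = 0"
proof (rule injD[OF inj_i])
  let ?F = "brG (brG x1 x2 x3) x4 x5 + brG x3 (brG x1 x2 x4) x5 + brG x3 x4 (brG x1 x2 x5)"
  let ?L = "i (psi x1 x2 (brG x3 x4 x5)) + i (rh x1 x2 (psi x3 x4 x5))"
  let ?R = "i (psi (brG x1 x2 x3) x4 x5) + i (rh x4 x5 (psi x1 x2 x3))
    + i (psi x3 (brG x1 x2 x4) x5) + i (rh x5 x3 (psi x1 x2 x4))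
    + i (psi x3 x4 (brG x1 x2 x5)) + i (rh x3 x4 (psi x1 x2 x5))"
  \<comment> \<open>By the fundamental identity of the quotient, \<open>?F\<close> is
    \<open>brG x1 x2 (brG x3 x4 x5)\<close>. Both sides of the identity upstairs thus share the
    section part \<open>s ?F\<close>, which cancels.\<close>
  have "s ?F + ?L = brH (s x1) (s x2) (brH (s x3) (s x4) (s x5))"
    unfolding P.B.fundamental_identity[symmetric]
    by (simp add: br_section br_one_kernel I.B.br_add)
  also have "\<dots> = brH (brH (s x1) (s x2) (s x3)) (s x4) (s x5)
      + brH (s x3) (brH (s x1) (s x2) (s x4)) (s x5) + brH (s x3) (s x4) (brH (s x1) (s x2) (s x5))"
    by (rule I.B.fundamental_identity)
  also have "\<dots> = s ?F + ?R"
    by (simp add: br_section br_one_kernel I.B.br_add s_add)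
  finally have "?L = ?R"
    by (simp only: add_left_cancel)
  moreover have "i (delta2 brG rh psi x1 x2 x3 x4 x5) = ?L - ?R"
    by (simp add: delta2_def i_add i_diff i_minus)
  ultimately show "i (delta2 brG rh psi x1 x2 x3 x4 x5) = i 0"
    by (simp only: diff_self i_zero)
qed

lemma partial1_chi_Phi2_psi:
  "- partial1 sG brG lam TG sM rh TM chi x y z - Phi2 lam TG sM TM psi x y z = 0"
proof (rule injD[OF inj_i])
  let ?P = "psi (TG x) (TG y) z + psi (TG x) y (TG z) + psi x (TG y) (TG z)
    + sM lam (psi (TG x) y z) + sM lam (psi x (TG y) z) + sM lam (psi x y (TG z))
    + sM (lam\<^sup>2) (psi x y z)"
  \<comment> \<open>\<open>R\<close> is the sum under \<open>TM\<close> in \<open>rho_T\<close>, so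
    that \<open>rho_T\<close> at \<open>u\<close>, \<open>v\<close>, \<open>m\<close> is
    \<open>rh (TG u) (TG v) m - TM (R u v m)\<close>.\<close>
  define R where "R u v m = rh (TG u) v m + rh u (TG v) m + sM lam (rh u v m)" for u v m
  let ?B = "rb_bracket sG brG lam TG x y z"
  let ?L = "i (psi (TG x) (TG y) (TG z))
    + i (rh (TG x) (TG y) (chi z)) + i (rh (TG y) (TG z) (chi x)) + i (rh (TG z) (TG x) (chi y))"
  let ?R = "i (chi ?B) + i (TM ?P)
    + i (TM (R x y (chi z))) + i (TM (R y z (chi x))) + i (TM (R z x (chi y)))"
  \<comment> \<open>Expanding each \<open>TH (s _)\<close>, the terms with two or three factors
    \<open>chi\<close> have two kernel entries and vanish.\<close>
  have "s (brG (TG x) (TG y) (TG z)) + ?L = brH (TH (s x)) (TH (s y)) (TH (s z))"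
    by (simp add: TH_section br_section br_one_kernel br_two_kernel I.B.br_add)
  also have "\<dots> = TH (rb_bracket sH brH lam TH (s x) (s y) (s z))"
    by (rule I.B.rota_baxter)
  \<comment> \<open>The terms with a single \<open>chi\<close>, weights included, group into the
    three values of \<open>R\<close>.\<close>
  also have "rb_bracket sH brH lam TH (s x) (s y) (s z)
      = s ?B + i (?P + (R x y (chi z) + R y z (chi x) + R z x (chi y)))"
    by (simp add: rb_bracket_def R_def TH_section br_section br_one_kernel br_two_kernel
        I.B.br_add s_add s_scale i_add i_scale I.B.scale_right_distrib)
  \<comment> \<open>Applying \<open>TH\<close> to \<open>s ?B\<close> yields \<open>chi ?B\<close>
    besides \<open>s (TG ?B)\<close>, which the Rota-Baxter identity of the quotient turns into the
    section part on the left; on the kernel \<open>TH\<close> acts as \<open>TM\<close>.\<close>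
  also have "TH \<dots> = s (brG (TG x) (TG y) (TG z)) + ?R"
    by (simp only: TH_add TH_section I.hom_T[symmetric] TM_add P.B.rota_baxter i_add ac_simps)
  finally have "?L = ?R"
    by (simp only: add_left_cancel add.assoc)
  moreover have "i (- partial1 sG brG lam TG sM rh TM chi x y z - Phi2 lam TG sM TM psi x y z) = ?R - ?L"
    unfolding partial1_def Phi2_def rho_T_def R_def[symmetric]
    by (simp add: i_add i_diff i_minus)
  ultimately show "i (- partial1 sG brG lam TG sM rh TM chi x y z - Phi2 lam TG sM TM psi x y z) = i 0"
    by (simp only: diff_self i_zero)
qed

lemma psi_chi_cocycle: "(psi, chi) \<in> rb_cocycles2 sG brG lam TG sM rh TM"
  unfolding rb_cocycles2_def rb_cochains2_def rb_d2_def mem_Collect_eq prod.case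
    delta2_psi partial1_chi_Phi2_psi
  by (intro conjI psi_alternating chi_linear refl)

end

end

theorem proposition5p4:
  fixes sM :: "'k::field_char_0 \<Rightarrow> 'm::ab_group_add \<Rightarrow> 'm"
    and sH :: "'k \<Rightarrow> 'h::ab_group_add \<Rightarrow> 'h"
    and sG :: "'k \<Rightarrow> 'g::ab_group_add \<Rightarrow> 'g"
    and lam :: 'k
  assumes "rb_abelian_extension sM TM sH brH TH sG brG T lam i p"
    and "linear_section sG sH p s"
  shows "(ext_psi brH brG i s, ext_chi TH T i s)
    \<in> rb_cocycles2 sG brG lam T sM (ext_rho brH i s) TM"
  using assms by (rule rb_abelian_extension.psi_chi_cocycle)

end
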